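(* Let $(Q,\cdot)$ be a quasigroup and $(Q,+)$ a (possibly noncommutative) group on the same underlying set. Suppose there are automorphisms $f,g$ of the group $(Q,+)$ and an element $e\in Q$ such that $xy=f(x)+e+g(y)$ for all $x,y\in Q$. Then: 1. $(Q,\cdot)$ is a left F-quasigroup if and only if $fg=gf$ and $-x+f(x)\in Z(Q,+)$ for all $x\in Q$. 2. $(Q,\cdot)$ is a right F-quasigroup if and only if $fg=gf$ and $-x+g(x)\in Z(Q,+)$ for all $x\in Q$. 3. $(Q,\cdot)$ is an F-quasigroup if and only if $fg=gf$ and both $-x+f(x)\in Z(Q,+)$ and $-x+g(x)\in Z(Q,+)$ for all $x\in Q$.
   Context: A quasigroup is a non-empty set $Q$ with a binary operation (written multiplicatively) such that all left translations $L_a:x\mapsto ax$ and all right translations $R_a:x\mapsto xa$ are permutations of $Q$. Juxtaposition binds more tightly than $\cdot$, so $xy\cdot zw$ means $(xy)(zw)$. In a quasigroup the maps $\alpha,\beta:Q\to Q$ are defined by $x\,\alpha(x)=x=\beta(x)\,x$. $Q$ is a left F-quasigroup if $x\cdot yz = xy\cdot\alpha(x)z$ for all $x,y,z\in Q$; a right F-quasigroup if $zy\cdot x = z\beta(x)\cdot yx$ for all $x,y,z\in Q$; an F-quasigroup if it is both. Groups are written additively even when noncommutative; $Z(Q,+)$ denotes the center of $(Q,+)$. *)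

theory Defs
  imports "HOL-Algebra.Group"
begin

locale quasigroup =
  fixes Q :: "'a set" and mul :: "'a \<Rightarrow> 'a \<Rightarrow> 'a" (infixl \<open>\<cdot>\<close> 70)
  assumes nonempty: "Q \<noteq> {}"
    and bij_left_translation: "a \<in> Q \<Longrightarrow> bij_betw (\<lambda>x. a \<cdot> x) Q Q"
    and bij_right_translation: "a \<in> Q \<Longrightarrow> bij_betw (\<lambda>x. x \<cdot> a) Q Q"
begin

definition \<alpha> :: "'a \<Rightarrow> 'a" where
  "\<alpha> x = (THE u. u \<in> Q \<and> x \<cdot> u = x)"

definition \<beta> :: "'a \<Rightarrow> 'a" where
  "\<beta> x = (THE u. u \<in> Q \<and> u \<cdot> x = x)"

lemma
  assumes "x \<in> Q"
  shows \<alpha>_closed: "\<alpha> x \<in> Q" and mul_\<alpha>: "x \<cdot> \<alpha> x = x"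
proof -
  have "\<exists>!u. u \<in> Q \<and> x \<cdot> u = x"
    using bij_left_translation[OF assms] assms unfolding bij_betw_def inj_on_def by (metis imageE)
  from theI'[OF this] show "\<alpha> x \<in> Q" "x \<cdot> \<alpha> x = x"
    by (auto simp: \<alpha>_def)
qed

lemma
  assumes "x \<in> Q"
  shows \<beta>_closed: "\<beta> x \<in> Q" and \<beta>_mul: "\<beta> x \<cdot> x = x"
proof -
  have "\<exists>!u. u \<in> Q \<and> u \<cdot> x = x"
    using bij_right_translation[OF assms] assms unfolding bij_betw_def inj_on_def by (metis imageE)
  from theI'[OF this] show "\<beta> x \<in> Q" "\<beta> x \<cdot> x = x"
    by (auto simp: \<beta>_def)
qed

end

locale left_F_quasigroup = quasigroup +
  assumes left_F: "\<lbrakk>x \<in> Q; y \<in> Q; z \<in> Q\<rbrakk> \<Longrightarrow> x \<cdot> (y \<cdot> z) = (x \<cdot> y) \<cdot> (\<alpha> x \<cdot> z)"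

locale right_F_quasigroup = quasigroup +
  assumes right_F: "\<lbrakk>x \<in> Q; y \<in> Q; z \<in> Q\<rbrakk> \<Longrightarrow> (z \<cdot> y) \<cdot> x = (z \<cdot> \<beta> x) \<cdot> (y \<cdot> x)"

locale F_quasigroup = left_F_quasigroup + right_F_quasigroup

definition group_center :: "('a, 'b) monoid_scheme \<Rightarrow> 'a set" where
  "group_center G = {z \<in> carrier G. \<forall>x \<in> carrier G. z \<otimes>\<^bsub>G\<^esub> x = x \<otimes>\<^bsub>G\<^esub> z}"

end

theory Submission
  imports Defs
begin

text \<open>
  Write $u = f(x) + e$, so that $x \cdot y = u + g(y)$; since $f$ is onto, $u$ runs through the whole
  group as $x$ does. Both sides of the left F-law end in the same term $g(e) + g(g(z))$, and
  cancelling it leaves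
  \[ u + g(f(y)) = f(u) + f(g(y)) + (e + g(f(\alpha(x)))). \]
  The case $y = 0$ says that the last bracket is $-f(u) + u$, so the law becomes an identity between
  two conjugations: $u + g(f(y)) - u = f(u) + f(g(y)) - f(u)$. At $u = 0$ it says $gf = fg$, and then
  it says that $-u + f(u)$ commutes with every $f(g(y))$, that is, with everything. The converse
  is a computation from $g(\alpha(x)) = -u + x$ (lemmas
  \<open>left_F_cancelled\<close>, \<open>conjugate_by_image_iff\<close> and \<open>left_F_iff\<close>).

  The right F-law for $(Q, \cdot)$ is the left F-law for the opposite quasigroup, which is
  presented over the opposite group, with $f$ and $g$ exchanged and $\beta$ in the role of $\alpha$;
  centrality does not notice the passage to the opposite group, because $g(x) - x$ is central if and
  only if $-x + g(x)$ is.
\<close>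

section \<open>Automorphisms that displace elements by central elements\<close>

context group
begin

lemma iso_self_simps:
  assumes "f \<in> iso G G"
  shows "\<And>x. x \<in> carrier G \<Longrightarrow> f x \<in> carrier G"
    and "\<And>x y. x \<in> carrier G \<Longrightarrow> y \<in> carrier G \<Longrightarrow> f (x \<otimes> y) = f x \<otimes> f y"
    and "f \<one> = \<one>"
    and "\<And>x. x \<in> carrier G \<Longrightarrow> f (inv x) = inv (f x)"
proof -
  have "f \<in> hom G G" using assms by (simp add: iso_def)
  then interpret group_hom G G f
    by unfold_locales
  show "\<And>x. x \<in> carrier G \<Longrightarrow> f x \<in> carrier G"
    "\<And>x y. x \<in> carrier G \<Longrightarrow> y \<in> carrier G \<Longrightarrow> f (x \<otimes> y) = f x \<otimes> f y"
    "f \<one> = \<one>" "\<And>x. x \<in> carrier G \<Longrightarrow> f (inv x) = inv (f x)"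
    by simp_all
qed

lemma iso_self_surj:
  assumes "f \<in> iso G G" and "y \<in> carrier G"
  obtains x where "x \<in> carrier G" and "f x = y"
proof -
  have "y \<in> f ` carrier G"
    using assms by (simp add: iso_def bij_betw_def)
  then show thesis
    using that by blast
qed

lemma center_displacement_obtain:
  assumes "x \<in> carrier G" "y \<in> carrier G" "inv x \<otimes> y \<in> group_center G"
  obtains c where "c \<in> group_center G" and "y = x \<otimes> c"
  using assms that[of "inv x \<otimes> y"] by (simp flip: m_assoc)

text \<open>If $y = x + c$ with $c$ central, then also $y = c + x$.\<close>

lemma center_displacement_commute:
  assumes "x \<in> carrier G" "y \<in> carrier G"
  shows "inv x \<otimes> y \<in> group_center G \<longleftrightarrow> y \<otimes> inv x \<in> group_center G"
proof
  assume "inv x \<otimes> y \<in> group_center G"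
  with assms obtain c where c: "c \<in> group_center G" "y = x \<otimes> c"
    by (rule center_displacement_obtain)
  then have "y \<otimes> inv x = c \<otimes> x \<otimes> inv x" "c \<in> carrier G"
    using assms by (auto simp: group_center_def)
  then show "y \<otimes> inv x \<in> group_center G"
    using c assms by (simp add: m_assoc)
next
  assume *: "y \<otimes> inv x \<in> group_center G"
  define c where "c = y \<otimes> inv x"
  have c: "c \<in> group_center G" "c \<in> carrier G" "y = c \<otimes> x"
    using * assms by (auto simp: c_def group_center_def m_assoc)
  then have "inv x \<otimes> y = inv x \<otimes> (x \<otimes> c)"
    using assms by (simp add: group_center_def)
  then show "inv x \<otimes> y \<in> group_center G"
    using c assms by (simp flip: m_assoc)
qed

lemma conjugate_eq_iff:
  assumes "u \<in> carrier G" "v \<in> carrier G" "w \<in> carrier G"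
  shows "u \<otimes> w \<otimes> inv u = v \<otimes> w \<otimes> inv v \<longleftrightarrow> (inv u \<otimes> v) \<otimes> w = w \<otimes> (inv u \<otimes> v)"
proof -
  have "u \<otimes> w \<otimes> inv u = v \<otimes> w \<otimes> inv v \<longleftrightarrow> u \<otimes> w \<otimes> inv u \<otimes> v = v \<otimes> w"
    using assms by (metis inv_closed inv_solve_right m_closed)
  also have "\<dots> \<longleftrightarrow> u \<otimes> (w \<otimes> (inv u \<otimes> v)) = u \<otimes> ((inv u \<otimes> v) \<otimes> w)"
    using assms by (simp flip: m_assoc)
  also have "\<dots> \<longleftrightarrow> w \<otimes> (inv u \<otimes> v) = (inv u \<otimes> v) \<otimes> w"
    using assms by simp
  also have "\<dots> \<longleftrightarrow> (inv u \<otimes> v) \<otimes> w = w \<otimes> (inv u \<otimes> v)"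
    by (rule eq_commute)
  finally show ?thesis .
qed

text \<open>
  The left-hand side is what remains of the left F-law once the quasigroup has been eliminated from
  it. At $u = 0$ it gives commutation; after that, both conjugations act on the same element
  $g(f(y))$, and these elements exhaust the group.
\<close>

lemma conjugate_by_image_iff:
  assumes f: "f \<in> iso G G" and g: "g \<in> iso G G"
  shows "(\<forall>u\<in>carrier G. \<forall>y\<in>carrier G. u \<otimes> g (f y) \<otimes> inv u = f u \<otimes> f (g y) \<otimes> inv (f u)) \<longleftrightarrow>
    (\<forall>x\<in>carrier G. f (g x) = g (f x)) \<and> (\<forall>x\<in>carrier G. inv x \<otimes> f x \<in> group_center G)"
    (is "?conj \<longleftrightarrow> ?comm \<and> ?central")
proof -
  note [simp] = iso_self_simps[OF f] iso_self_simps[OF g]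
  have comm: ?comm if ?conj
    using that[rule_format, OF one_closed] by simp
  have central: "?conj \<longleftrightarrow> ?central" if ?comm
  proof -
    have "?conj \<longleftrightarrow> (\<forall>u\<in>carrier G. \<forall>y\<in>carrier G.
        (inv u \<otimes> f u) \<otimes> g (f y) = g (f y) \<otimes> (inv u \<otimes> f u))"
      using that by (simp add: conjugate_eq_iff)
    also have "\<dots> \<longleftrightarrow> (\<forall>u\<in>carrier G. \<forall>w\<in>carrier G.
        (inv u \<otimes> f u) \<otimes> w = w \<otimes> (inv u \<otimes> f u))"
    proof -
      have "(\<forall>y\<in>carrier G. P (g (f y))) \<longleftrightarrow> (\<forall>w\<in>carrier G. P w)" for P
      proof -
        have "(\<forall>y\<in>carrier G. P (g (f y))) \<longleftrightarrow> (\<forall>w\<in>g ` f ` carrier G. P w)"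
          by (simp only: ball_simps)
        also have "g ` f ` carrier G = carrier G"
          using f g by (simp add: iso_def bij_betw_def)
        finally show ?thesis .
      qed
      then show ?thesis
        by (rule ball_cong[OF refl])
    qed
    finally show ?thesis
      by (simp add: group_center_def)
  qed
  show ?thesis
    using comm central by blast
qed

end

section \<open>Quasigroups presented over a group\<close>

locale group_presented_quasigroup =
  group G + quasigroup "carrier G" mul
  for G (structure) and mul (infixl \<open>\<cdot>\<close> 70) +
  fixes f g e
  assumes f_iso: "f \<in> iso G G" and g_iso: "g \<in> iso G G" and e_closed [simp]: "e \<in> carrier G"
    and mul_eq: "x \<in> carrier G \<Longrightarrow> y \<in> carrier G \<Longrightarrow> x \<cdot> y = f x \<otimes> e \<otimes> g y"
begin

lemmas f_simps [simp] = iso_self_simps[OF f_iso]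
lemmas g_simps [simp] = iso_self_simps[OF g_iso]
declare \<alpha>_closed [simp]

lemma mul_closed [simp]: "x \<in> carrier G \<Longrightarrow> y \<in> carrier G \<Longrightarrow> x \<cdot> y \<in> carrier G"
  by (simp add: mul_eq)

lemma g_\<alpha>:
  assumes "x \<in> carrier G"
  shows "g (\<alpha> x) = inv (f x \<otimes> e) \<otimes> x"
proof -
  have "f x \<otimes> e \<otimes> g (\<alpha> x) = x"
    using mul_\<alpha>[OF assms] assms by (simp add: mul_eq)
  then show ?thesis
    using assms by (simp add: inv_solve_left)
qed

text \<open>
  The variable $z$ disappears here: it occurs only in the final summand $g(e) + g(g(z))$, which is
  common to both sides.
\<close>

lemma left_F_cancelled:
  "left_F_quasigroup (carrier G) (\<cdot>) \<longleftrightarrow>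
    (\<forall>x\<in>carrier G. \<forall>y\<in>carrier G.
      (f x \<otimes> e) \<otimes> g (f y) = f (f x \<otimes> e) \<otimes> f (g y) \<otimes> (e \<otimes> g (f (\<alpha> x))))"
proof -
  have "x \<cdot> (y \<cdot> z) = (x \<cdot> y) \<cdot> (\<alpha> x \<cdot> z) \<longleftrightarrow>
      (f x \<otimes> e) \<otimes> g (f y) = f (f x \<otimes> e) \<otimes> f (g y) \<otimes> (e \<otimes> g (f (\<alpha> x)))"
    if [simp]: "x \<in> carrier G" "y \<in> carrier G" "z \<in> carrier G" for x y z
  proof -
    have "x \<cdot> (y \<cdot> z) = (f x \<otimes> e) \<otimes> g (f y) \<otimes> (g e \<otimes> g (g z))"
      by (simp add: mul_eq m_assoc)
    moreover have "(x \<cdot> y) \<cdot> (\<alpha> x \<cdot> z) =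
        f (f x \<otimes> e) \<otimes> f (g y) \<otimes> (e \<otimes> g (f (\<alpha> x))) \<otimes> (g e \<otimes> g (g z))"
      by (simp add: mul_eq m_assoc)
    ultimately show ?thesis
      by simp
  qed
  then show ?thesis
    unfolding left_F_quasigroup_def left_F_quasigroup_axioms_def
    using quasigroup_axioms one_closed by blast
qed

theorem left_F_iff:
  "left_F_quasigroup (carrier G) (\<cdot>) \<longleftrightarrow>
    (\<forall>x\<in>carrier G. f (g x) = g (f x)) \<and> (\<forall>x\<in>carrier G. inv x \<otimes> f x \<in> group_center G)"
    (is "?F \<longleftrightarrow> ?comm \<and> ?central")
proof -
  let ?conj = "\<forall>u\<in>carrier G. \<forall>y\<in>carrier G.
    u \<otimes> g (f y) \<otimes> inv u = f u \<otimes> f (g y) \<otimes> inv (f u)"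
  have conj_iff: "?conj \<longleftrightarrow> ?comm \<and> ?central"
    by (rule conjugate_by_image_iff[OF f_iso g_iso])
  have solve: "u \<otimes> a \<otimes> inv u = v \<otimes> b \<otimes> inv v \<longleftrightarrow> u \<otimes> a = v \<otimes> b \<otimes> (inv v \<otimes> u)"
    if "u \<in> carrier G" "v \<in> carrier G" "a \<in> carrier G" "b \<in> carrier G" for u v a b
  proof -
    have "v \<otimes> b \<otimes> inv v = v \<otimes> b \<otimes> (inv v \<otimes> u) \<otimes> inv u"
      using that by (simp add: m_assoc)
    then show ?thesis
      using that by simp
  qed
  show ?thesis
  proof
    assume ?F
    then have F: "(f x \<otimes> e) \<otimes> g (f y) = f (f x \<otimes> e) \<otimes> f (g y) \<otimes> (e \<otimes> g (f (\<alpha> x)))"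
      if "x \<in> carrier G" "y \<in> carrier G" for x y
      using that left_F_cancelled by blast
    have ?conj
    proof (intro ballI)
      fix u y assume [simp]: "u \<in> carrier G" "y \<in> carrier G"
      obtain x where [simp]: "x \<in> carrier G" and "f x = u \<otimes> inv e"
        using iso_self_surj[OF f_iso, of "u \<otimes> inv e"] by auto
      then have u: "f x \<otimes> e = u"
        by (simp add: m_assoc)
      have "u = f u \<otimes> (e \<otimes> g (f (\<alpha> x)))"
        using F[of x \<one>] unfolding u by simp
      then have "e \<otimes> g (f (\<alpha> x)) = inv (f u) \<otimes> u"
        by (simp add: inv_solve_left)
      then show "u \<otimes> g (f y) \<otimes> inv u = f u \<otimes> f (g y) \<otimes> inv (f u)"
        using F[of x y] unfolding u by (subst solve) simp_all
    qed
    then show "?comm \<and> ?central"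
      by (simp only: conj_iff)
  next
    assume R: "?comm \<and> ?central"
    then have ?conj
      by (simp only: conj_iff)
    show ?F
      unfolding left_F_cancelled
    proof (intro ballI)
      fix x y assume [simp]: "x \<in> carrier G" "y \<in> carrier G"
      define u where "u = f x \<otimes> e"
      have [simp]: "u \<in> carrier G"
        by (simp add: u_def)
      obtain c where c: "c \<in> group_center G" and fu: "f u = u \<otimes> c"
        using R center_displacement_obtain[of u "f u"] by auto
      from c have [simp]: "c \<in> carrier G"
        and c_comm: "\<And>w. w \<in> carrier G \<Longrightarrow> w \<otimes> c = c \<otimes> w"
        unfolding group_center_def by auto
      \<comment> \<open>Both sides of the next equation are $-c$, where $f(u) = u + c$.\<close>
      have "e \<otimes> g (f (\<alpha> x)) = inv (f u) \<otimes> u"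
      proof -
        have "g (f (\<alpha> x)) = f (inv u \<otimes> x)"
          using R g_\<alpha>[of x] by (metis \<alpha>_closed \<open>x \<in> carrier G\<close> u_def)
        also have "\<dots> = inv (u \<otimes> c) \<otimes> f x"
          by (simp add: fu)
        also have "u \<otimes> c = f x \<otimes> c \<otimes> e"
          using c_comm by (simp add: u_def m_assoc)
        finally have "e \<otimes> g (f (\<alpha> x)) = e \<otimes> (inv e \<otimes> (inv c \<otimes> (inv (f x) \<otimes> f x)))"
          by (simp add: inv_mult_group m_assoc del: l_inv)
        also have "\<dots> = inv c"
          by (simp add: l_inv flip: m_assoc)
        also have "\<dots> = inv (f u) \<otimes> u"
          by (simp add: fu inv_mult_group m_assoc)
        finally show ?thesis .
      qed
      then show "f x \<otimes> e \<otimes> g (f y) = f (f x \<otimes> e) \<otimes> f (g y) \<otimes> (e \<otimes> g (f (\<alpha> x)))"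
        using \<open>?conj\<close> solve[of u "f u" "g (f y)" "f (g y)"] unfolding u_def[symmetric] by simp
    qed
  qed
qed

end

section \<open>Passage to the opposite\<close>

definition opposite :: "('a, 'b) monoid_scheme \<Rightarrow> ('a, 'b) monoid_scheme" where
  "opposite G = G\<lparr>mult := \<lambda>x y. y \<otimes>\<^bsub>G\<^esub> x\<rparr>"

lemma opposite_simps [simp]:
  "carrier (opposite G) = carrier G"
  "x \<otimes>\<^bsub>opposite G\<^esub> y = y \<otimes>\<^bsub>G\<^esub> x"
  "\<one>\<^bsub>opposite G\<^esub> = \<one>\<^bsub>G\<^esub>"
  "inv\<^bsub>opposite G\<^esub> x = inv\<^bsub>G\<^esub> x"
  "iso (opposite G) (opposite G) = iso G G"
  "group_center (opposite G) = group_center G"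
  by (auto simp: opposite_def m_inv_def iso_def hom_def group_center_def conj_commute)

lemma group_opposite:
  assumes "group G"
  shows "group (opposite G)"
proof -
  interpret group G by fact
  show ?thesis
    by (rule groupI) (auto simp: m_assoc intro: r_inv_ex)
qed

lemma quasigroup_opposite:
  assumes "quasigroup Q mul"
  shows "quasigroup Q (\<lambda>x y. mul y x)"
  using assms by (simp add: quasigroup_def)

lemma right_F_iff_left_F_opposite:
  assumes "quasigroup Q mul"
  shows "right_F_quasigroup Q mul \<longleftrightarrow> left_F_quasigroup Q (\<lambda>x y. mul y x)"
proof -
  have "quasigroup.\<alpha> Q (\<lambda>x y. mul y x) = quasigroup.\<beta> Q mul"
    using quasigroup.\<alpha>_def[OF quasigroup_opposite[OF assms]] quasigroup.\<beta>_def[OF assms]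
    by (simp add: fun_eq_iff)
  then show ?thesis
    using assms quasigroup_opposite[OF assms]
    by (auto simp: right_F_quasigroup_def right_F_quasigroup_axioms_def
        left_F_quasigroup_def left_F_quasigroup_axioms_def)
qed

context group_presented_quasigroup
begin

lemma opposite_presentation:
  "group_presented_quasigroup (opposite G) (\<lambda>x y. y \<cdot> x) g f e"
proof -
  interpret op: group "opposite G"
    by (rule group_opposite) (rule group_axioms)
  show ?thesis
    by (intro group_presented_quasigroup.intro group_presented_quasigroup_axioms.intro
        op.group_axioms)
      (simp_all add: quasigroup_opposite quasigroup_axioms f_iso g_iso mul_eq m_assoc)
qed

theorem right_F_iff:
  "right_F_quasigroup (carrier G) (\<cdot>) \<longleftrightarrow>
    (\<forall>x\<in>carrier G. f (g x) = g (f x)) \<and> (\<forall>x\<in>carrier G. inv x \<otimes> g x \<in> group_center G)"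
proof -
  have "right_F_quasigroup (carrier G) (\<cdot>) \<longleftrightarrow>
      (\<forall>x\<in>carrier G. g (f x) = f (g x)) \<and> (\<forall>x\<in>carrier G. g x \<otimes> inv x \<in> group_center G)"
    using group_presented_quasigroup.left_F_iff[OF opposite_presentation]
    by (simp add: right_F_iff_left_F_opposite quasigroup_axioms)
  then show ?thesis
    by (simp add: center_displacement_commute eq_commute)
qed

end

section \<open>The characterization\<close>

theorem lemma3p1:
  fixes Q :: "'a set"
    and mul :: "'a \<Rightarrow> 'a \<Rightarrow> 'a" (infixl \<open>\<cdot>\<close> 70)
    and G :: "('a, 'b) monoid_scheme" (structure)
    and f g :: "'a \<Rightarrow> 'a" and e :: 'a
  assumes "quasigroup Q mul"
    and "group G" and "carrier G = Q"
    and "f \<in> iso G G" and "g \<in> iso G G" and "e \<in> Q"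
    and "\<forall>x\<in>Q. \<forall>y\<in>Q. x \<cdot> y = f x \<otimes> e \<otimes> g y"
  shows "(left_F_quasigroup Q mul \<longleftrightarrow>
           (\<forall>x\<in>Q. f (g x) = g (f x)) \<and> (\<forall>x\<in>Q. inv x \<otimes> f x \<in> group_center G)) \<and>
         (right_F_quasigroup Q mul \<longleftrightarrow>
           (\<forall>x\<in>Q. f (g x) = g (f x)) \<and> (\<forall>x\<in>Q. inv x \<otimes> g x \<in> group_center G)) \<and>
         (F_quasigroup Q mul \<longleftrightarrow>
           (\<forall>x\<in>Q. f (g x) = g (f x)) \<and>
           (\<forall>x\<in>Q. inv x \<otimes> f x \<in> group_center G \<and> inv x \<otimes> g x \<in> group_center G))"
proof -
  interpret group_presented_quasigroup G mul f g e
    using assms by (auto simp: group_presented_quasigroup_def group_presented_quasigroup_axioms_def)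
  show ?thesis
    using left_F_iff right_F_iff by (auto simp: F_quasigroup_def assms(3))
qed

end
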